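(* Let $p$ be a prime. Then there exists a positive integer $k$ such that the following holds for every $n$. Let $\mathcal{F}\subset \mathbb{F}_p^{n}$ be $k$-closed. Then $\dim(\langle \mathcal{F}\rangle_{p})\leq \lfloor n/p\rfloor$; in particular $|\mathcal{F}|\leq p^{\lfloor n/p\rfloor}$. Moreover, this bound is best possible: for every $n$ there is a $k$-closed $\mathcal{F}\subset\mathbb{F}_p^n$ with $|\mathcal{F}|=p^{\lfloor n/p\rfloor}$.
   Context: $\langle\mathcal{F}\rangle_p$ is the $\mathbb{F}_p$-span of $\mathcal{F}$. With $v\cdot w$ the coordinatewise product in $\mathbb{F}_p^n$, $\mathcal{F}^i=\{v_1\cdot\ldots\cdot v_i: v_j\in\mathcal{F}\}$ (not necessarily distinct factors) and $\|v\|=\sum_{j=1}^n v(j)\in\mathbb{F}_p$, the set $\mathcal{F}$ is $k$-closed if $\|v\|=0$ for all $1\le i\le k$ and all $v\in\mathcal{F}^i$. *)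

theory Defs
  imports "Berlekamp_Zassenhaus.Finite_Field" "Jordan_Normal_Form.VS_Connect"
begin

text \<open>
  For a type variable \<open>'p :: prime_card\<close>, the prime is \<open>p = CARD('p)\<close>, the field
  \<open>F_p\<close> is \<open>'p mod_ring\<close>, and \<open>F_p^n\<close> is \<open>carrier_vec n :: 'p mod_ring vec set\<close>, with
  coordinates indexed from \<open>0\<close>.
\<close>

text \<open>The set of coordinatewise products of \<open>i\<close> (not necessarily distinct) members of \<open>F\<close>.\<close>

definition coord_power :: "nat \<Rightarrow> 'a :: comm_semiring_1 vec set \<Rightarrow> nat \<Rightarrow> 'a vec set" where
  "coord_power n F i = {vec n (\<lambda>j. \<Prod>l<i. v l $ j) | v. \<forall>l<i. v l \<in> F}"

definition coord_sum :: "'a :: comm_semiring_1 vec \<Rightarrow> 'a" where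
  "coord_sum v = (\<Sum>j<dim_vec v. v $ j)"

definition k_closed :: "nat \<Rightarrow> nat \<Rightarrow> 'a :: comm_semiring_1 vec set \<Rightarrow> bool" where
  "k_closed k n F \<longleftrightarrow> (\<forall>i. 1 \<le> i \<and> i \<le> k \<longrightarrow> (\<forall>v \<in> coord_power n F i. coord_sum v = 0))"

definition span_dim :: "nat \<Rightarrow> 'a :: field vec set \<Rightarrow> nat" where
  "span_dim n F = vectorspace.dim class_ring
     (module_vec TYPE('a) n
        \<lparr>carrier := LinearCombinations.module.span class_ring (module_vec TYPE('a) n) F\<rparr>)"

end

theory Submission
  imports Defs
begin

text \<open>
  View the coordinates as points at which the members of \<open>F\<close> are evaluated, with multiplicities, and
  let \<open>W t\<close> be the span of the products of between \<open>1\<close> and \<open>t\<close> members. Being \<open>k\<close>-closed means that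
  every \<open>f \<in> W k\<close> has weighted sum \<open>0\<close>, so no such \<open>f\<close> is supported on a single point among the set
  \<open>T\<close> of points whose multiplicity is prime to \<open>p\<close>. If \<open>W 1\<close> had rank \<open>r\<close> on \<open>T\<close> with \<open>|T| < p r\<close>,
  the ranks of \<open>W 1, W 2, W 4, \<dots>\<close> on \<open>T\<close> could not keep growing by a constant factor. Where the growth
  is slow there is a function of low degree with fewer than \<open>2 p\<close> nonzero values on \<open>T\<close>, and
  multiplying it by linear functions that separate points isolates a point: a contradiction. Hence
  \<open>|T| \<ge> p r\<close>. The remaining points have multiplicity at least \<open>p\<close> each, so the rank of \<open>F\<close> is at
  most \<open>n / p\<close>.
\<close>

text \<open>Coordinates in a finite basis are unique. This turns a bound on the size of a span into
  a bound on its dimension.\<close>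

lemma (in vectorspace) card_carrier_eq_power_dim:
  assumes "fin_dim"
  shows "card (carrier V) = card (carrier K) ^ dim"
proof -
  obtain B where B: "finite B" "basis B"
    using finite_basis_exists[OF assms] by blast
  have BV: "B \<subseteq> carrier V"
    using B(2) by (simp add: basis_def)
  have unique: "\<forall>v. v \<in> carrier V \<longrightarrow> (\<exists>!a. a \<in> B \<rightarrow>\<^sub>E carrier K \<and> lincomb a B = v)"
    using basis_criterion[OF B(1) BV] B(2) by blast
  have closed: "lincomb a B \<in> carrier V" if "a \<in> B \<rightarrow>\<^sub>E carrier K" for a
    using that BV by (intro lincomb_closed) auto
  have "bij_betw (\<lambda>a. lincomb a B) (B \<rightarrow>\<^sub>E carrier K) (carrier V)"
    unfolding bij_betw_def
  proof
    show "inj_on (\<lambda>a. lincomb a B) (B \<rightarrow>\<^sub>E carrier K)"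
      using unique closed by (intro inj_onI) metis
    show "(\<lambda>a. lincomb a B) ` (B \<rightarrow>\<^sub>E carrier K) = carrier V"
      using unique closed by blast
  qed
  then have "card (carrier V) = card (B \<rightarrow>\<^sub>E carrier K)"
    by (metis bij_betw_same_card)
  then show ?thesis
    by (simp add: card_PiE B(1) dim_basis[OF B])
qed

section \<open>Rank of a function space via interpolating and determining sets\<close>

definition fun_subspace :: "('x \<Rightarrow> 'a :: field) set \<Rightarrow> bool" where
  "fun_subspace W \<longleftrightarrow> (\<lambda>_. 0) \<in> W \<and>
     (\<forall>f\<in>W. \<forall>g\<in>W. (\<lambda>x. f x + g x) \<in> W) \<and> (\<forall>c. \<forall>f\<in>W. (\<lambda>x. c * f x) \<in> W)"

text \<open>A substitute for dimension: a subset of \<open>T\<close> that is both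
  \<open>interpolating\<close> and determining has as many elements as the rank of \<open>W\<close>
  on \<open>T\<close>.\<close>

definition determining :: "('x \<Rightarrow> 'a :: zero) set \<Rightarrow> 'x set \<Rightarrow> 'x set \<Rightarrow> bool" where
  "determining W T Z \<longleftrightarrow> (\<forall>f\<in>W. (\<forall>z\<in>Z. f z = 0) \<longrightarrow> (\<forall>x\<in>T. f x = 0))"

definition interpolating :: "('x \<Rightarrow> 'a :: zero_neq_one) set \<Rightarrow> 'x set \<Rightarrow> bool" where
  "interpolating W Y \<longleftrightarrow> (\<forall>y\<in>Y. \<exists>f\<in>W. f y = 1 \<and> (\<forall>z\<in>Y - {y}. f z = 0))"

lemma
  assumes "fun_subspace W"
  shows fun_subspace_zero: "(\<lambda>_. 0) \<in> W"
    and fun_subspace_add: "f \<in> W \<Longrightarrow> g \<in> W \<Longrightarrow> (\<lambda>x. f x + g x) \<in> W"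
    and fun_subspace_scale: "f \<in> W \<Longrightarrow> (\<lambda>x. c * f x) \<in> W"
  using assms by (auto simp: fun_subspace_def)

lemma fun_subspace_diff_scale:
  assumes "fun_subspace W" "f \<in> W" "g \<in> W"
  shows "(\<lambda>x. f x - c * g x) \<in> W"
  using fun_subspace_add[OF assms(1,2) fun_subspace_scale[OF assms(1,3), of "- c"]] by simp

lemma fun_subspace_sum:
  assumes "fun_subspace W" "\<And>a. a \<in> A \<Longrightarrow> f a \<in> W"
  shows "(\<lambda>x. \<Sum>a\<in>A. f a x) \<in> W"
  using assms(2)
proof (induction A rule: infinite_finite_induct)
  case (insert a A)
  then show ?case
    using fun_subspace_add[OF assms(1), of "f a" "\<lambda>x. \<Sum>a\<in>A. f a x"] by simp
qed (simp_all add: fun_subspace_zero[OF assms(1)])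

lemma determiningD:
  "determining W T Z \<Longrightarrow> f \<in> W \<Longrightarrow> (\<And>z. z \<in> Z \<Longrightarrow> f z = 0) \<Longrightarrow> x \<in> T \<Longrightarrow> f x = 0"
  by (auto simp: determining_def)

lemma interpolatingD:
  assumes "interpolating W Y" "y \<in> Y"
  obtains f where "f \<in> W" "f y = 1" "\<And>z. z \<in> Y \<Longrightarrow> z \<noteq> y \<Longrightarrow> f z = 0"
  using assms by (force simp: interpolating_def)

text \<open>A multiple of \<open>f\<close> is dual to \<open>x\<close>; subtracting multiples of
  \<open>f\<close> makes the old dual functions vanish at \<open>x\<close>.\<close>

lemma interpolating_insert:
  assumes W: "fun_subspace W" and Y: "interpolating W Y"
    and f: "f \<in> W" "\<And>z. z \<in> Y \<Longrightarrow> f z = 0" "f x \<noteq> 0"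
  shows "interpolating W (insert x Y)"
  unfolding interpolating_def
proof
  fix y assume y: "y \<in> insert x Y"
  have "x \<notin> Y"
    using f by blast
  show "\<exists>h\<in>W. h y = 1 \<and> (\<forall>z\<in>insert x Y - {y}. h z = 0)"
  proof (cases "y = x")
    case True
    with f \<open>x \<notin> Y\<close> show ?thesis
      by (intro bexI[OF _ fun_subspace_scale[OF W f(1), of "1 / f x"]]) auto
  next
    case False
    then obtain g where g: "g \<in> W" "g y = 1" "\<And>z. z \<in> Y \<Longrightarrow> z \<noteq> y \<Longrightarrow> g z = 0"
      using interpolatingD[OF Y] y by blast
    with f y False show ?thesis
      by (intro bexI[OF _ fun_subspace_diff_scale[OF W g(1) f(1), of "g x / f x"]]) (auto, blast)
  qed
qed

text \<open>A maximal interpolating set above \<open>Y\<close> is determining, since otherwise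
  \<open>interpolating_insert\<close> would enlarge it.\<close>

lemma interpolating_extend_determining:
  assumes W: "fun_subspace W" and T: "finite T" and Y: "Y \<subseteq> T" "interpolating W Y"
  obtains Z where "Y \<subseteq> Z" "Z \<subseteq> T" "interpolating W Z" "determining W T Z"
proof -
  define S where "S = {Z. Y \<subseteq> Z \<and> Z \<subseteq> T \<and> interpolating W Z}"
  have "finite S" "Y \<in> S"
    using T Y finite_subset[of S "Pow T"] by (auto simp: S_def)
  then obtain Z where Z: "Z \<in> S" "\<And>Z'. Z' \<in> S \<Longrightarrow> Z \<subseteq> Z' \<Longrightarrow> Z = Z'"
    using finite_has_maximal2 by metis
  have "determining W T Z"
    unfolding determining_def
  proof (intro ballI impI, rule ccontr)
    fix f x assume f: "f \<in> W" "\<forall>z\<in>Z. f z = 0" "x \<in> T" "f x \<noteq> 0"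
    then have "insert x Z \<in> S"
      using Z(1) interpolating_insert[OF W _ f(1), of Z x] by (auto simp: S_def)
    then have "x \<in> Z"
      using Z(2) by blast
    with f show False by blast
  qed
  with Z(1) show thesis
    by (intro that) (auto simp: S_def)
qed

text \<open>Combinations of dual functions realise all value patterns on \<open>Y\<close>, and their
  values on \<open>Z\<close> tell them apart; over a finite field counting patterns
  suffices.\<close>

lemma card_interpolating_le_determining:
  fixes W :: "('x \<Rightarrow> 'a :: {field, finite}) set"
  assumes W: "fun_subspace W" and fin: "finite T" "finite Z"
    and Y: "Y \<subseteq> T" "interpolating W Y" and Z: "determining W T Z"
  shows "card Y \<le> card Z"
proof -
  have "finite Y"
    using Y(1) fin(1) finite_subset by blast
  obtain d where d: "\<And>y. y \<in> Y \<Longrightarrow> d y \<in> W \<and> d y y = 1 \<and> (\<forall>z\<in>Y - {y}. d y z = 0)"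
    using Y(2) unfolding interpolating_def by metis
  define comb where "comb a x = (\<Sum>y\<in>Y. a y * d y x)" for a x
  have comb_in: "comb a \<in> W" for a
    unfolding comb_def using d by (intro fun_subspace_sum[OF W] fun_subspace_scale[OF W]) auto
  have comb_at: "comb a y = a y" if "y \<in> Y" for a y
  proof -
    have "comb a y = (\<Sum>z\<in>Y. if z = y then a z else 0)"
      unfolding comb_def using d that by (intro sum.cong) auto
    also have "\<dots> = a y"
      using \<open>finite Y\<close> that by simp
    finally show ?thesis .
  qed
  have "inj_on (\<lambda>a. restrict (comb a) Z) (Y \<rightarrow>\<^sub>E UNIV)"
  proof (rule inj_onI)
    fix a b :: "'x \<Rightarrow> 'a"
    assume ab: "a \<in> Y \<rightarrow>\<^sub>E UNIV" "b \<in> Y \<rightarrow>\<^sub>E UNIV" "restrict (comb a) Z = restrict (comb b) Z"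
    have "comb a z - 1 * comb b z = 0" if "z \<in> Z" for z
      using fun_cong[OF ab(3), of z] that by simp
    then have "comb a y - 1 * comb b y = 0" if "y \<in> Y" for y
      using determiningD[OF Z fun_subspace_diff_scale[OF W comb_in[of a] comb_in[of b], of 1], of y]
        that Y(1) by auto
    then show "a = b"
      using ab(1,2) by (intro PiE_ext) (auto simp: comb_at)
  qed
  then have "card (Y \<rightarrow>\<^sub>E (UNIV :: 'a set)) \<le> card (Z \<rightarrow>\<^sub>E (UNIV :: 'a set))"
    using fin(2) by (intro card_inj_on_le[where f = "\<lambda>a. restrict (comb a) Z"] finite_PiE) auto
  moreover have "CARD('a) > 1"
    using card_mono[of "UNIV :: 'a set" "{0, 1}"] by simp
  ultimately show ?thesis
    using fin(2) \<open>finite Y\<close> by (simp add: card_PiE)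
qed

section \<open>Sparse functions where the rank grows slowly\<close>

text \<open>
  Let \<open>K \<subseteq> W\<close> consist of the functions vanishing on \<open>R = Y2 - Y\<close>. If \<open>f\<^sub>y \<in> W\<close> and \<open>e\<^sub>y \<in> W2\<close> are
  dual to \<open>y\<close> on \<open>Y\<close> and on \<open>Y2\<close>, then \<open>f f\<^sub>y = f(y) e\<^sub>y\<close> for all \<open>f \<in> K\<close>, since the difference lies
  in \<open>W2\<close> and vanishes on \<open>Y2\<close>. Hence at every point of the support of \<open>e\<^sub>y\<close> the evaluation on \<open>K\<close> is
  proportional to the evaluation at \<open>y\<close>. There are at least \<open>|Y| - |R|\<close> classes of pairwise
  proportional evaluations, and the smallest of them is small.
\<close>

lemma exists_sparse_function:
  fixes W W2 :: "('x \<Rightarrow> 'a :: {field, finite}) set"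
  assumes W: "fun_subspace W" and W2: "fun_subspace W2"
    and mult: "\<And>f g. f \<in> W \<Longrightarrow> g \<in> W \<Longrightarrow> (\<lambda>x. f x * g x) \<in> W2"
    and T: "finite T" and sub: "Y \<subseteq> Y2" "Y2 \<subseteq> T" and ne: "Y \<noteq> {}"
    and Y: "interpolating W Y" "determining W T Y"
    and Y2: "interpolating W2 Y2" "determining W2 T Y2"
    and small: "2 * card (Y2 - Y) \<le> card Y"
  obtains y e where "y \<in> Y" "e \<in> W2" "e y = 1" "card {x\<in>T. e x \<noteq> 0} * card Y \<le> 2 * card T"
proof -
  define R where "R = Y2 - Y"
  define K where "K = {f\<in>W. \<forall>r\<in>R. f r = 0}"
  have fin: "finite Y" "finite Y2" "finite R"
    using finite_subset[OF sub(2) T] finite_subset[OF sub(1)] by (auto simp: R_def)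
  have K: "fun_subspace K" "K \<subseteq> W"
    using W unfolding fun_subspace_def K_def by auto
  have "interpolating K {}"
    by (simp add: interpolating_def)
  then obtain Z where Z: "Z \<subseteq> Y" "interpolating K Z" "determining K Y Z"
    by (rule interpolating_extend_determining[OF K(1) fin(1) empty_subsetI])
  have finZ: "finite Z"
    using Z(1) fin(1) finite_subset by blast
  \<comment> \<open>Vanishing on \<open>R\<close> puts a function into \<open>K\<close>, where
    \<open>Z\<close> controls \<open>Y\<close>, and \<open>Y\<close> controls \<open>T\<close>. So
    \<open>Z\<close> has at least half as many points as \<open>Y\<close>.\<close>
  have "determining W T (Z \<union> R)"
    unfolding determining_def
  proof (intro ballI impI)
    fix f x assume f: "f \<in> W" "\<forall>z\<in>Z \<union> R. f z = 0" "x \<in> T"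
    then have "f \<in> K" by (auto simp: K_def)
    then have "f y = 0" if "y \<in> Y" for y
      using determiningD[OF Z(3)] f(2) that by blast
    then show "f x = 0"
      using determiningD[OF Y(2) f(1)] f(3) by blast
  qed
  moreover have "finite (Z \<union> R)" "Y \<subseteq> T"
    using finZ fin sub by auto
  ultimately have "card Y \<le> card (Z \<union> R)"
    by (intro card_interpolating_le_determining[OF W T _ _ Y(1)])
  also have "\<dots> \<le> card Z + card R"
    by (rule card_Un_le)
  finally have cardZ: "card Y \<le> 2 * card Z"
    using small by (simp add: R_def)
  define cl where "cl y = {x\<in>T. \<exists>c. c \<noteq> 0 \<and> (\<forall>f\<in>K. f x = c * f y)}" for y
  have disj: "cl y \<inter> cl z = {}" if "y \<in> Z" "z \<in> Z" "y \<noteq> z" for y z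
  proof (rule ccontr)
    assume "cl y \<inter> cl z \<noteq> {}"
    then obtain x c c' where x: "c \<noteq> 0" "\<forall>f\<in>K. f x = c * f y" "\<forall>f\<in>K. f x = c' * f z"
      unfolding cl_def by blast
    obtain g where g: "g \<in> K" "g y = 1" "\<And>z. z \<in> Z \<Longrightarrow> z \<noteq> y \<Longrightarrow> g z = 0"
      using interpolatingD[OF Z(2) \<open>y \<in> Z\<close>] by blast
    have "g x = c" "g x = 0"
      using x(2,3) g that by auto
    with x(1) show False by simp
  qed
  have "Z \<noteq> {}"
    using cardZ ne fin(1) by auto
  obtain y where y: "y \<in> Z" "\<And>z. z \<in> Z \<Longrightarrow> card (cl y) \<le> card (cl z)"
    using ex_is_arg_min_if_finite[OF finZ \<open>Z \<noteq> {}\<close>, of "\<lambda>z. card (cl z)"]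
    by (auto simp: is_arg_min_linorder)
  have "card Z * card (cl y) \<le> (\<Sum>z\<in>Z. card (cl z))"
    using sum_bounded_below[of Z "card (cl y)" "\<lambda>z. card (cl z)"] y(2) by simp
  also have "\<dots> = card (\<Union>z\<in>Z. cl z)"
    using disj T finZ by (intro card_UN_disjoint[symmetric]) (auto simp: cl_def)
  also have "\<dots> \<le> card T"
    using T by (intro card_mono) (auto simp: cl_def)
  finally have card_cl: "card Z * card (cl y) \<le> card T" .
  have yY: "y \<in> Y" "y \<in> Y2"
    using y(1) Z(1) sub by auto
  obtain d where d: "d \<in> W" "d y = 1" "\<And>z. z \<in> Y \<Longrightarrow> z \<noteq> y \<Longrightarrow> d z = 0"
    using interpolatingD[OF Y(1) yY(1)] by blast
  obtain e where e: "e \<in> W2" "e y = 1" "\<And>z. z \<in> Y2 \<Longrightarrow> z \<noteq> y \<Longrightarrow> e z = 0"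
    using interpolatingD[OF Y2(1) yY(2)] by blast
  \<comment> \<open>For this \<open>g\<close> the identity \<open>prod\<close> reads
    \<open>g x * d x = e x\<close>, so \<open>d\<close> has no zero on the support of
    \<open>e\<close> in \<open>T\<close>.\<close>
  obtain g where g: "g \<in> K" "g y = 1"
    using Z(2) y(1) by (auto simp: interpolating_def)
  have prod: "f x * d x = f y * e x" if "f \<in> K" "x \<in> T" for f x
  proof -
    have zero: "f z * d z - f y * e z = 0" if "z \<in> Y2" for z
    proof (cases "z \<in> R")
      case True
      then have "f z = 0" "z \<noteq> y"
        using \<open>f \<in> K\<close> yY(1) by (auto simp: K_def R_def)
      then show ?thesis using e(3)[OF that] by simp
    next
      case False
      then have "z \<in> Y" using that by (simp add: R_def)
      then show ?thesis using d(2,3) e(2,3) that by (cases "z = y") auto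
    qed
    have "(\<lambda>x. f x * d x - f y * e x) \<in> W2"
      using that(1) K(2) d(1) e(1) by (intro fun_subspace_diff_scale[OF W2] mult) auto
    from determiningD[OF Y2(2) this zero that(2)] show ?thesis by simp
  qed
  have "{x\<in>T. e x \<noteq> 0} \<subseteq> cl y"
  proof
    fix x assume "x \<in> {x\<in>T. e x \<noteq> 0}"
    then have x: "x \<in> T" "e x \<noteq> 0" by auto
    then have "d x \<noteq> 0"
      using prod[OF g(1) x(1)] g(2) by auto
    then have "f x = (e x / d x) * f y" if "f \<in> K" for f
      using prod[OF that x(1)] by (simp add: field_simps)
    then show "x \<in> cl y"
      using x \<open>d x \<noteq> 0\<close> unfolding cl_def by (auto intro!: exI[of _ "e x / d x"])
  qed
  then have "card {x\<in>T. e x \<noteq> 0} \<le> card (cl y)"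
    using T by (intro card_mono) (auto simp: cl_def)
  then have "card {x\<in>T. e x \<noteq> 0} * card Y \<le> card (cl y) * (2 * card Z)"
    using cardZ by (rule mult_le_mono)
  also have "\<dots> \<le> 2 * card T"
    using card_cl by (simp add: mult.commute)
  finally show thesis
    using yY(1) e(1,2) by (intro that)
qed

section \<open>Filtrations by degree and isolation of a point\<close>

locale fun_filtration =
  fixes W :: "nat \<Rightarrow> ('x \<Rightarrow> 'a :: {field, finite}) set"
  assumes subspace: "fun_subspace (W i)"
    and mono: "i \<le> j \<Longrightarrow> W i \<subseteq> W j"
    and mult: "f \<in> W i \<Longrightarrow> g \<in> W j \<Longrightarrow> (\<lambda>x. f x * g x) \<in> W (i + j)"
begin

text \<open>Multiply \<open>e\<close> by a factor \<open>l - l a\<close> for each \<open>a\<close>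
  in \<open>S\<close>, with \<open>l\<close> separating \<open>a\<close> from \<open>y\<close>.
  Constants need not lie in \<open>W 1\<close>, so each product is expanded as
  \<open>f * l - l a * f\<close>.\<close>

lemma isolate_in_sparse:
  assumes "finite S"
    and "\<And>x. x \<in> S \<Longrightarrow> \<exists>l\<in>W 1. l x \<noteq> l y"
    and "e \<in> W s" "e y \<noteq> 0"
  shows "\<exists>f\<in>W (s + card S). f y \<noteq> 0 \<and> (\<forall>x\<in>S. f x = 0) \<and> (\<forall>x. e x = 0 \<longrightarrow> f x = 0)"
  using assms(1,2)
proof (induction S)
  case empty
  with assms(3,4) show ?case by auto
next
  case (insert a S)
  then obtain f where f: "f \<in> W (s + card S)" "f y \<noteq> 0" "\<forall>x\<in>S. f x = 0" "\<forall>x. e x = 0 \<longrightarrow> f x = 0"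
    by auto
  obtain l where l: "l \<in> W 1" "l a \<noteq> l y"
    using insert.prems by blast
  have "(\<lambda>x. f x * l x - l a * f x) \<in> W (s + card S + 1)"
    using mult[OF f(1) l(1)] f(1) mono[of "s + card S" "s + card S + 1"]
    by (intro fun_subspace_diff_scale[OF subspace]) auto
  moreover have "f y * l y - l a * f y \<noteq> 0"
    using f(2) l(2) by (simp add: mult.commute)
  ultimately show ?case
    using f insert.hyps by (intro bexI[of _ "\<lambda>x. f x * l x - l a * f x"]) (auto simp: mult.commute)
qed

text \<open>
  If no function isolates a point, then doubling the degree enlarges the rank of \<open>W (2^i)\<close> on \<open>T\<close>
  by at least half of \<open>card Y\<close>; after \<open>2 * C\<close> doublings it would exceed \<open>card T\<close>.
\<close>

lemma exists_isolating_function: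
  assumes T: "finite T" and Y: "Y \<subseteq> T" "interpolating (W 1) Y" "determining (W 1) T Y"
    and sep: "\<And>x y. x \<in> T \<Longrightarrow> y \<in> T \<Longrightarrow> x \<noteq> y \<Longrightarrow> \<exists>l\<in>W 1. l x \<noteq> l y"
    and small: "card T < C * card Y" and k: "k \<ge> 2 ^ (2 * C) + 2 * C"
  shows "\<exists>f\<in>W k. \<exists>y\<in>T. f y \<noteq> 0 \<and> (\<forall>x\<in>T - {y}. f x = 0)"
proof (rule ccontr)
  assume no_iso: "\<not> ?thesis"
  have "\<exists>Z\<subseteq>T. interpolating (W (2 ^ i)) Z \<and> determining (W (2 ^ i)) T Z \<and>
      (2 + i) * card Y \<le> 2 * card Z" if "i \<le> 2 * C" for i
    using that
  proof (induction i)
    case 0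
    with Y show ?case by auto
  next
    case (Suc i)
    then obtain Z where Z: "Z \<subseteq> T" "interpolating (W (2 ^ i)) Z" "determining (W (2 ^ i)) T Z"
        "(2 + i) * card Y \<le> 2 * card Z"
      by auto
    have finZ: "finite Z"
      using Z(1) T finite_subset by blast
    have YZ: "card Y \<le> card Z"
      using Z(4) by simp
    have "W (2 ^ i) \<subseteq> W (2 ^ Suc i)"
      by (intro mono) simp
    then have "interpolating (W (2 ^ Suc i)) Z"
      using Z(2) unfolding interpolating_def by blast
    then obtain Z2 where Z2: "Z \<subseteq> Z2" "Z2 \<subseteq> T" "interpolating (W (2 ^ Suc i)) Z2"
        "determining (W (2 ^ Suc i)) T Z2"
      using interpolating_extend_determining[OF subspace T Z(1)] by blast
    have card_diff: "card Z + card (Z2 - Z) = card Z2"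
      using Z2(1,2) T finite_subset[of Z2 T] finZ card_mono[of Z2 Z]
      by (simp add: card_Diff_subset)
    have "card Z < 2 * card (Z2 - Z)"
    proof (rule ccontr)
      assume "\<not> ?thesis"
      then have le: "2 * card (Z2 - Z) \<le> card Z" by simp
      have "Z \<noteq> {}"
        using YZ small by auto
      have mult': "(\<lambda>x. f x * g x) \<in> W (2 ^ Suc i)" if "f \<in> W (2 ^ i)" "g \<in> W (2 ^ i)" for f g
        using mult[OF that] by (simp add: mult_2)
      obtain y e where e: "y \<in> Z" "e \<in> W (2 ^ Suc i)" "e y = 1"
          "card {x\<in>T. e x \<noteq> 0} * card Z \<le> 2 * card T"
        using exists_sparse_function[OF subspace subspace mult' T Z2(1,2) \<open>Z \<noteq> {}\<close> Z(2,3) Z2(3,4) le]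
        by blast
      define S where "S = {x\<in>T. e x \<noteq> 0} - {y}"
      have "y \<in> T" using e(1) Z(1) by blast
      have "card {x\<in>T. e x \<noteq> 0} * card Z < 2 * C * card Z"
        using e(4) small mult_le_mono2[OF YZ, of C] by linarith
      then have "card {x\<in>T. e x \<noteq> 0} < 2 * C"
        by simp
      then have cardS: "card S \<le> 2 * C"
        using card_Diff1_le[of "{x\<in>T. e x \<noteq> 0}" y] unfolding S_def by linarith
      have "finite S" "\<And>x. x \<in> S \<Longrightarrow> \<exists>l\<in>W 1. l x \<noteq> l y"
        using T sep[OF _ \<open>y \<in> T\<close>] by (auto simp: S_def)
      from isolate_in_sparse[OF this e(2)] e(3) obtain f
        where f: "f \<in> W (2 ^ Suc i + card S)" "f y \<noteq> 0" "\<forall>x\<in>S. f x = 0" "\<forall>x. e x = 0 \<longrightarrow> f x = 0"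
        by auto
      \<comment> \<open>The two summands in the bound on \<open>k\<close> are the largest degree of
        \<open>e\<close> and the largest number of separating factors.\<close>
      have "(2 :: nat) ^ Suc i \<le> 2 ^ (2 * C)"
        using Suc.prems by (intro power_increasing) auto
      then have "2 ^ Suc i + card S \<le> k"
        using cardS k by linarith
      then have "f \<in> W k"
        using f(1) mono by blast
      moreover have "\<forall>x\<in>T - {y}. f x = 0"
        using f(3,4) by (auto simp: S_def)
      ultimately show False
        using no_iso f(2) \<open>y \<in> T\<close> by blast
    qed
    then have "(2 + Suc i) * card Y \<le> 2 * card Z2"
      using Z(4) YZ card_diff by (simp add: algebra_simps)
    with Z2 show ?case by blast
  qed
  from this[of "2 * C"] obtain Z where Z: "Z \<subseteq> T" "(2 + 2 * C) * card Y \<le> 2 * card Z"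
    by auto
  then have "(2 + 2 * C) * card Y \<le> 2 * card T"
    using card_mono[OF T Z(1)] by linarith
  with small show False
    by (simp add: algebra_simps)
qed

end

section \<open>Functions generated in bounded degree\<close>

text \<open>Degree \<open>t\<close> gives the span of the products of between 1 and \<open>t\<close>
  members of \<open>G\<close>. The constant 1 is not put in, because closedness says nothing about
  the empty product.\<close>

inductive generated :: "('x \<Rightarrow> 'a :: comm_ring_1) set \<Rightarrow> nat \<Rightarrow> ('x \<Rightarrow> 'a) \<Rightarrow> bool" for G where
  zero: "generated G t (\<lambda>_. 0)"
| generator: "f \<in> G \<Longrightarrow> generated G (Suc t) f"
| add: "generated G t f \<Longrightarrow> generated G t g \<Longrightarrow> generated G t (\<lambda>x. f x + g x)"
| scale: "generated G t f \<Longrightarrow> generated G t (\<lambda>x. c * f x)"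
| mult: "generated G s f \<Longrightarrow> generated G t g \<Longrightarrow> generated G (s + t) (\<lambda>x. f x * g x)"

lemma generated_mono: "generated G s f \<Longrightarrow> s \<le> t \<Longrightarrow> generated G t f"
proof (induction arbitrary: t rule: generated.induct)
  case (generator f s)
  then show ?case
    using generated.generator[of f G "t - 1"] by simp
next
  case (mult s f r g)
  then have "generated G s f" "generated G (t - s) g"
    by auto
  from generated.mult[OF this] mult.prems show ?case by simp
qed (auto intro: generated.intros)

lemma fun_subspace_generated: "fun_subspace {f. generated G i f}"
  by (simp add: fun_subspace_def generated.zero generated.add generated.scale)

lemma fun_filtration_generated:
  fixes G :: "('x \<Rightarrow> 'a :: {field, finite}) set"
  shows "fun_filtration (\<lambda>t. {f. generated G t f})"
proof unfold_locales
  show "fun_subspace {f. generated G i f}" for i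
    by (rule fun_subspace_generated)
  show "{f. generated G i f} \<subseteq> {f. generated G j f}" if "i \<le> j" for i j
    using that generated_mono by blast
  show "(\<lambda>x. f x * g x) \<in> {f. generated G (i + j) f}"
    if "f \<in> {f. generated G i f}" "g \<in> {f. generated G j f}" for f g i j
    using that by (simp add: generated.mult)
qed

text \<open>
  The weights \<open>\<mu>\<close> are universally quantified inside the induction because a product is treated by
  moving one factor into the weight.
\<close>

lemma sum_generated_eq_0:
  assumes "generated G s f"
    and "\<And>ls. set ls \<subseteq> G \<Longrightarrow> ls \<noteq> [] \<Longrightarrow> length ls \<le> s \<Longrightarrow>
      (\<Sum>i\<in>A. \<mu> i * (\<Prod>l\<leftarrow>ls. l (pt i))) = 0"
  shows "(\<Sum>i\<in>A. \<mu> i * f (pt i)) = 0"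
  using assms
proof (induction arbitrary: \<mu> rule: generated.induct)
  case (generator f t)
  from generator.prems[of "[f]"] generator.hyps show ?case by simp
next
  case (add t f g)
  then show ?case by (simp add: distrib_left sum.distrib)
next
  case (scale t f c)
  from scale.IH[OF scale.prems] have "c * (\<Sum>i\<in>A. \<mu> i * f (pt i)) = 0"
    by simp
  then show ?case by (simp add: sum_distrib_left mult.left_commute)
next
  case (mult s f t g)
  have "(\<Sum>i\<in>A. (\<mu> i * g (pt i)) * f (pt i)) = 0"
  proof (rule mult.IH(1))
    fix ls assume ls: "set ls \<subseteq> G" "ls \<noteq> []" "length ls \<le> s"
    have "(\<Sum>i\<in>A. (\<mu> i * (\<Prod>l\<leftarrow>ls. l (pt i))) * g (pt i)) = 0"
    proof (rule mult.IH(2))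
      fix ls' assume "set ls' \<subseteq> G" "ls' \<noteq> []" "length ls' \<le> t"
      then show "(\<Sum>i\<in>A. (\<mu> i * (\<Prod>l\<leftarrow>ls. l (pt i))) * (\<Prod>l\<leftarrow>ls'. l (pt i))) = 0"
        using mult.prems[of "ls @ ls'"] ls by (simp add: mult.assoc)
    qed
    then show "(\<Sum>i\<in>A. (\<mu> i * g (pt i)) * (\<Prod>l\<leftarrow>ls. l (pt i))) = 0"
      by (simp add: mult_ac)
  qed
  then show ?case by (simp add: mult_ac)
qed simp

section \<open>Coordinates as points with multiplicity\<close>

text \<open>
  Coordinates on which all members of \<open>F\<close> agree give the same point, so each point carries a
  multiplicity, and \<open>\<Sum>j<n. f (point F j)\<close> weights \<open>f\<close> with these multiplicities.
\<close>

definition point :: "'a :: zero vec set \<Rightarrow> nat \<Rightarrow> 'a vec \<Rightarrow> 'a" where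
  "point F j = (\<lambda>v. if v \<in> F then v $ j else 0)"

definition evaluations :: "'a vec set \<Rightarrow> (('a vec \<Rightarrow> 'a) \<Rightarrow> 'a) set" where
  "evaluations F = (\<lambda>v x. x v) ` F"

text \<open>A product of evaluations at \<open>point F j\<close> is entry \<open>j\<close> of a
  coordinatewise product, so closedness supplies the hypothesis of \<open>sum_generated_eq_0\<close>
  with unit weights.\<close>

lemma k_closed_sum_generated_eq_0:
  assumes closed: "k_closed k n F" and f: "generated (evaluations F) k f"
  shows "(\<Sum>j<n. f (point F j)) = 0"
proof -
  have "(\<Sum>j<n. 1 * f (point F j)) = 0"
    using f
  proof (rule sum_generated_eq_0)
    fix ls assume ls: "set ls \<subseteq> evaluations F" "ls \<noteq> []" "length ls \<le> k"
    then have "ls \<in> lists ((\<lambda>v x. x v) ` F)"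
      by (auto simp: evaluations_def)
    then obtain vs where vs: "set vs \<subseteq> F" "ls = map (\<lambda>v x. x v) vs"
      unfolding lists_image by auto
    have "vec n (\<lambda>j. \<Prod>l<length vs. (vs ! l) $ j) \<in> coord_power n F (length vs)"
      using vs(1) unfolding coord_power_def by (auto intro!: exI[of _ "\<lambda>l. vs ! l"])
    then have "coord_sum (vec n (\<lambda>j. \<Prod>l<length vs. (vs ! l) $ j)) = 0"
      using closed ls(2,3) vs(2) unfolding k_closed_def by (auto simp: Suc_le_eq)
    then have "(\<Sum>j<n. \<Prod>l<length vs. (vs ! l) $ j) = 0"
      by (simp add: coord_sum_def)
    moreover have "(\<Prod>l\<leftarrow>ls. l (point F j)) = (\<Prod>l<length vs. (vs ! l) $ j)" for j
    proof -
      have "(\<Prod>l\<leftarrow>ls. l (point F j)) = (\<Prod>v\<leftarrow>vs. v $ j)"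
        using vs by (auto simp: point_def comp_def intro!: arg_cong[of _ _ prod_list])
      then show ?thesis
        by (simp add: prod.list_conv_set_nth atLeast0LessThan)
    qed
    ultimately show "(\<Sum>j<n. 1 * (\<Prod>l\<leftarrow>ls. l (point F j))) = 0"
      by simp
  qed
  then show ?thesis by simp
qed

lemma k_closed_determining:
  fixes F :: "'p :: prime_card mod_ring vec set"
  assumes closed: "k_closed k n F" and k: "k \<ge> 2 ^ (2 * CARD('p)) + 2 * CARD('p)"
  obtains Z where "finite Z" "card Z \<le> n div CARD('p)"
    "determining {f. generated (evaluations F) 1 f} (point F ` {..<n}) Z"
proof -
  define W where "W t = {f. generated (evaluations F) t f}" for t
  interpret fun_filtration W
    unfolding W_def by (rule fun_filtration_generated)
  define P where "P = point F ` {..<n}"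
  define m where "m x = card {j\<in>{..<n}. point F j = x}" for x
  define T where "T = {x\<in>P. \<not> CARD('p) dvd m x}"
  define B where "B = {x\<in>P. CARD('p) dvd m x}"
  have fin: "finite P" "finite T" "finite B" and PTB: "P = T \<union> B" "T \<inter> B = {}"
    by (auto simp: P_def T_def B_def)
  have "interpolating (W 1) {}"
    by (simp add: interpolating_def)
  then obtain Y where Y: "Y \<subseteq> T" "interpolating (W 1) Y" "determining (W 1) T Y"
    by (rule interpolating_extend_determining[OF subspace fin(2) empty_subsetI])
  have finY: "finite Y"
    using Y(1) fin(2) finite_subset by blast
  have sep: "\<exists>l\<in>W 1. l x \<noteq> l y" if "x \<in> T" "y \<in> T" "x \<noteq> y" for x y
  proof -
    obtain v where v: "x v \<noteq> y v"
      using \<open>x \<noteq> y\<close> by blast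
    \<comment> \<open>Points take the default value 0 outside \<open>F\<close>, so they can differ
      only at members of \<open>F\<close>.\<close>
    then have "v \<in> F"
      using that(1,2) by (auto simp: T_def P_def point_def split: if_splits)
    then have "(\<lambda>x. x v) \<in> W 1"
      using generated.generator[of "\<lambda>x. x v" "evaluations F" 0] by (auto simp: W_def evaluations_def)
    with v show ?thesis
      by (intro bexI[of _ "\<lambda>x. x v"])
  qed
  have "CARD('p) * card Y \<le> card T"
  proof (rule ccontr)
    assume "\<not> ?thesis"
    then have "card T < CARD('p) * card Y" by simp
    from exists_isolating_function[OF fin(2) Y sep this k] obtain f y
      where f: "f \<in> W k" "y \<in> T" "f y \<noteq> 0" "\<forall>x\<in>T - {y}. f x = 0"
      by blast
    \<comment> \<open>Grouping coordinates by point gives the weights \<open>m x\<close>. Those on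
      \<open>B\<close> are 0 modulo \<open>p\<close> and \<open>f\<close> vanishes on the rest of
      \<open>T\<close>, so only the term of \<open>y\<close> survives.\<close>
    have "(\<Sum>j<n. f (point F j)) = (\<Sum>x\<in>P. \<Sum>j\<in>{j\<in>{..<n}. point F j = x}. f (point F j))"
      unfolding P_def by (rule sum.image_gen) simp
    also have "\<dots> = (\<Sum>x\<in>P. of_nat (m x) * f x)"
      by (intro sum.cong) (auto simp: m_def)
    also have "\<dots> = (\<Sum>x\<in>{y}. of_nat (m x) * f x)"
    proof (rule sum.mono_neutral_right)
      show "\<forall>x\<in>P - {y}. of_nat (m x) * f x = 0"
      proof
        fix x assume x: "x \<in> P - {y}"
        show "of_nat (m x) * f x = 0"
        proof (cases "x \<in> T")
          case True
          with x f(4) show ?thesis by simp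
        next
          case False
          with x obtain c where "m x = CARD('p) * c"
            by (auto simp: T_def)
          then show ?thesis by simp
        qed
      qed
    qed (use fin PTB f(2) in auto)
    finally have "of_nat (m y) * f y = 0"
      using k_closed_sum_generated_eq_0[OF closed] f(1) by (simp add: W_def)
    then have "of_nat (m y) = (0 :: 'p mod_ring)"
      using f(3) by simp
    then show False
      using of_nat_0_mod_ring_dvd f(2) by (auto simp: T_def)
  qed
  \<comment> \<open>Every multiplicity is positive, hence at least \<open>p\<close> when
    \<open>p\<close> divides it.\<close>
  moreover have "card T + CARD('p) * card B \<le> n"
  proof -
    have m_pos: "m x > 0" if "x \<in> P" for x
      using that by (auto simp: m_def P_def card_gt_0_iff)
    have "card T \<le> (\<Sum>x\<in>T. m x)"
      using sum_bounded_below[of T 1 m] m_pos by (simp add: PTB Suc_le_eq)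
    moreover have "CARD('p) * card B \<le> (\<Sum>x\<in>B. m x)"
      using sum_bounded_below[of B "CARD('p)" m] m_pos dvd_imp_le[of "CARD('p)"]
      by (simp add: B_def mult.commute)
    moreover have "(\<Sum>x\<in>T. m x) + (\<Sum>x\<in>B. m x) = (\<Sum>x\<in>P. m x)"
      unfolding PTB(1) using fin PTB(2) by (intro sum.union_disjoint[symmetric])
    moreover have "n = (\<Sum>x\<in>P. m x)"
      using sum.image_gen[of "{..<n}" "\<lambda>_. 1 :: nat" "point F"] by (simp add: P_def m_def)
    ultimately show ?thesis by linarith
  qed
  moreover have "card (Y \<union> B) \<le> card Y + card B"
    by (rule card_Un_le)
  ultimately have "card (Y \<union> B) * CARD('p) \<le> n"
    using mult_le_mono2[of "card (Y \<union> B)" "card Y + card B" "CARD('p)"]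
    by (simp add: distrib_left mult.commute)
  then have "card (Y \<union> B) \<le> n div CARD('p)"
    by (simp add: less_eq_div_iff_mult_less_eq)
  moreover have "determining (W 1) P (Y \<union> B)"
    using Y(3) unfolding determining_def PTB(1) by blast
  ultimately show thesis
    using that[of "Y \<union> B"] finY fin(3) by (simp add: W_def P_def)
qed

section \<open>The upper bound\<close>

lemma (in vec_space) span_imp_generated:
  assumes F: "F \<subseteq> carrier_vec n" and v: "v \<in> span F"
  shows "\<exists>f. generated (evaluations F) 1 f \<and> (\<forall>j<n. f (point F j) = v $ j)"
proof -
  obtain a A where A: "finite A" "A \<subseteq> F" "v = lincomb a A"
    using v unfolding span_def by auto
  have "fun_subspace {f. generated (evaluations F) 1 f}"
    by (rule fun_subspace_generated)
  moreover have "generated (evaluations F) 1 (\<lambda>x. a w * x w)" if "w \<in> A" for w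
    using that A(2) generated.generator[of "\<lambda>x. x w" "evaluations F" 0]
    by (auto simp: evaluations_def intro!: generated.scale)
  ultimately have "generated (evaluations F) 1 (\<lambda>x. \<Sum>w\<in>A. a w * x w)"
    using fun_subspace_sum[of "{f. generated (evaluations F) 1 f}" A "\<lambda>w x. a w * x w"] by simp
  moreover have "(\<Sum>w\<in>A. a w * point F j w) = v $ j" if "j < n" for j
    using A F that by (auto simp: lincomb_index point_def intro!: sum.cong)
  ultimately show ?thesis
    by (intro exI[of _ "\<lambda>x. \<Sum>w\<in>A. a w * x w"]) simp
qed

text \<open>A vector of the span is recovered from the values on \<open>Z\<close> of a function
  \<open>h v\<close> extending it to points. Counting these values bounds the span, and so both
  \<open>F\<close> and the dimension.\<close>

lemma k_closed_span_dim_le: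
  fixes F :: "'p :: prime_card mod_ring vec set"
  assumes F: "F \<subseteq> carrier_vec n" and closed: "k_closed k n F"
    and k: "k \<ge> 2 ^ (2 * CARD('p)) + 2 * CARD('p)"
  shows "span_dim n F \<le> n div CARD('p)" "card F \<le> CARD('p) ^ (n div CARD('p))"
proof -
  interpret vec_space "TYPE('p mod_ring)" n .
  let ?W = "{f. generated (evaluations F) 1 f}"
  obtain Z where Z: "finite Z" "card Z \<le> n div CARD('p)" "determining ?W (point F ` {..<n}) Z"
    by (rule k_closed_determining[OF closed k])
  have W: "fun_subspace ?W"
    by (rule fun_subspace_generated)
  obtain h where h: "\<And>v. v \<in> span F \<Longrightarrow> h v \<in> ?W"
      "\<And>v j. v \<in> span F \<Longrightarrow> j < n \<Longrightarrow> h v (point F j) = v $ j"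
    using span_imp_generated[OF F] unfolding mem_Collect_eq by metis
  have span_sub: "span F \<subseteq> carrier_vec n"
    using F span_closed by auto
  have inj: "inj_on (\<lambda>v. restrict (h v) Z) (span F)"
  proof (rule inj_onI)
    fix v w assume vw: "v \<in> span F" "w \<in> span F" "restrict (h v) Z = restrict (h w) Z"
    have zero: "h v z - 1 * h w z = 0" if "z \<in> Z" for z
      using fun_cong[OF vw(3), of z] that by simp
    have "h v x - 1 * h w x = 0" if "x \<in> point F ` {..<n}" for x
      using determiningD[OF Z(3) fun_subspace_diff_scale[OF W h(1)[OF vw(1)] h(1)[OF vw(2)]] zero that]
      by simp
    then have "v $ j = w $ j" if "j < n" for j
      using h(2)[OF vw(1) that] h(2)[OF vw(2) that] that by auto
    moreover have "v \<in> carrier_vec n" "w \<in> carrier_vec n"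
      using vw(1,2) span_sub by auto
    ultimately show "v = w"
      by (intro eq_vecI) auto
  qed
  have finPi: "finite (Z \<rightarrow>\<^sub>E (UNIV :: 'p mod_ring set))"
    using Z(1) by (intro finite_PiE) auto
  have im: "(\<lambda>v. restrict (h v) Z) ` span F \<subseteq> Z \<rightarrow>\<^sub>E UNIV"
    by auto
  have fin: "finite (span F)"
    using inj_on_finite[OF inj im finPi] .
  have F_span: "F \<subseteq> span F"
    using in_own_span[OF F] .
  have "card (span F) \<le> CARD('p) ^ card Z"
    using card_inj_on_le[OF inj im finPi] Z(1) by (simp add: card_PiE)
  also have "\<dots> \<le> CARD('p) ^ (n div CARD('p))"
    using Z(2) by (intro power_increasing) auto
  finally have card_span: "card (span F) \<le> CARD('p) ^ (n div CARD('p))" .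
  show "card F \<le> CARD('p) ^ (n div CARD('p))"
    using card_mono[OF fin F_span] card_span by linarith
  have FV: "F \<subseteq> carrier V"
    using F by simp
  have finF: "finite F"
    using F_span fin finite_subset by blast
  have vs: "vectorspace class_ring (vs (span F))"
    using span_is_subspace[OF F] subspace_is_vs by blast
  have "card (span F) = CARD('p) ^ span_dim n F"
    using vectorspace.card_carrier_eq_power_dim[OF vs fin_dim_span[OF finF FV]]
    by (simp add: span_dim_def)
  with card_span show "span_dim n F \<le> n div CARD('p)"
    using prime_card[where 'a = 'p] prime_gt_1_nat power_le_imp_le_exp by metis
qed

section \<open>Families attaining the bound\<close>

lemma sum_div_blocks:
  fixes h :: "nat \<Rightarrow> 'a :: comm_semiring_1"
  assumes "p > 0"
  shows "(\<Sum>j<q * p. h (j div p)) = of_nat p * (\<Sum>b<q. h b)"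
proof -
  have "(\<Sum>j<q * p. h (j div p)) = (\<Sum>b<q. \<Sum>j = b * p..<b * p + p. h (j div p))"
    by (rule sum.nat_group[symmetric])
  also have "\<dots> = (\<Sum>b<q. \<Sum>j = b * p..<b * p + p. h b)"
  proof (intro sum.cong refl)
    fix b j assume "j \<in> {b * p..<b * p + p}"
    then have "j div p = b"
      by (intro div_nat_eqI) (auto simp: mult.commute)
    then show "h (j div p) = h b" by simp
  qed
  finally show ?thesis
    by (simp add: sum_distrib_left)
qed

text \<open>Take the vectors constant on each of \<open>n div p\<close> consecutive blocks of length
  \<open>p\<close> and 0 on the remaining coordinates. Their products have the same shape, so every
  coordinate sum is a multiple of \<open>p\<close>.\<close>

lemma exists_block_constant_k_closed:
  "\<exists>F :: 'p :: prime_card mod_ring vec set.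
     F \<subseteq> carrier_vec n \<and> k_closed k n F \<and> card F = CARD('p) ^ (n div CARD('p))"
proof -
  define p where "p = CARD('p)"
  define q where "q = n div p"
  define bc :: "(nat \<Rightarrow> 'p mod_ring) \<Rightarrow> 'p mod_ring vec"
    where "bc a = vec n (\<lambda>j. if j div p < q then a (j div p) else 0)" for a
  define F where "F = bc ` ({..<q} \<rightarrow>\<^sub>E UNIV)"
  have p: "p > 0"
    by (simp add: p_def)
  have qp: "q * p \<le> n"
    by (simp add: q_def)
  have bc_carrier: "bc a \<in> carrier_vec n" for a
    by (simp add: bc_def)
  have "F \<subseteq> carrier_vec n"
    unfolding F_def using bc_carrier by blast
  moreover have "k_closed k n F"
    unfolding k_closed_def
  proof (intro allI impI ballI)
    fix i u assume i: "1 \<le> i \<and> i \<le> k" and "u \<in> coord_power n F i"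
    then obtain v where v: "\<forall>l<i. v l \<in> F" "u = vec n (\<lambda>j. \<Prod>l<i. v l $ j)"
      by (auto simp: coord_power_def)
    then have "\<forall>l<i. \<exists>a. v l = bc a"
      unfolding F_def by blast
    then obtain a where a: "\<And>l. l < i \<Longrightarrow> v l = bc (a l)"
      by metis
    \<comment> \<open>Here \<open>1 \<le> i\<close> matters: an empty product would be 1 on the
      coordinates beyond the blocks.\<close>
    have entry: "(\<Prod>l<i. v l $ j) = (if j < q * p then \<Prod>l<i. a l (j div p) else 0)"
      if "j < n" for j
    proof -
      have "(\<Prod>l<i. v l $ j) = (\<Prod>l<i. if j div p < q then a l (j div p) else 0)"
        using that by (intro prod.cong) (simp_all add: a bc_def)
      then show ?thesis
        using i p by (cases "j div p < q") (auto simp: div_less_iff_less_mult power_0_left)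
    qed
    have "coord_sum u = (\<Sum>j<n. if j < q * p then \<Prod>l<i. a l (j div p) else 0)"
      by (simp add: coord_sum_def v(2) entry)
    also have "\<dots> = (\<Sum>j\<in>{..<n} \<inter> {j. j < q * p}. \<Prod>l<i. a l (j div p))"
      by (simp add: sum.If_cases)
    also have "{..<n} \<inter> {j. j < q * p} = {..<q * p}"
      using qp by auto
    also have "(\<Sum>j<q * p. \<Prod>l<i. a l (j div p)) = 0"
      using sum_div_blocks[OF p, of "\<lambda>b. \<Prod>l<i. a l b" q] by (simp add: p_def)
    finally show "coord_sum u = 0" .
  qed
  moreover have "inj_on bc ({..<q} \<rightarrow>\<^sub>E UNIV)"
  proof (rule inj_onI)
    fix a b assume ab: "a \<in> {..<q} \<rightarrow>\<^sub>E UNIV" "b \<in> {..<q} \<rightarrow>\<^sub>E UNIV" "bc a = bc b"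
    have "a c = b c" if "c < q" for c
    proof -
      have "Suc c * p \<le> q * p"
        using that by (intro mult_le_mono1) simp
      then have "c * p < n"
        using qp p by simp
      with that p show ?thesis
        using arg_cong[OF ab(3), of "\<lambda>v. v $ (c * p)"] by (simp add: bc_def)
    qed
    then show "a = b"
      using ab(1,2) by (intro PiE_ext) auto
  qed
  then have "card F = CARD('p) ^ (n div CARD('p))"
    by (simp add: F_def card_image card_PiE q_def p_def)
  ultimately show ?thesis by blast
qed

theorem theorem3p11:
  shows "\<exists>k>0.
    (\<forall>n. \<forall>F :: 'p :: prime_card mod_ring vec set.
       F \<subseteq> carrier_vec n \<longrightarrow> k_closed k n F \<longrightarrow>
         span_dim n F \<le> n div CARD('p) \<and> card F \<le> CARD('p) ^ (n div CARD('p))) \<and>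
    (\<forall>n. \<exists>F :: 'p mod_ring vec set.
       F \<subseteq> carrier_vec n \<and> k_closed k n F \<and> card F = CARD('p) ^ (n div CARD('p)))"
  \<comment> \<open>The witness is the degree bound of \<open>exists_isolating_function\<close> at
    \<open>C = p\<close>.\<close>
  by (rule exI[of _ "2 ^ (2 * CARD('p)) + 2 * CARD('p)"])
    (simp add: k_closed_span_dim_le exists_block_constant_k_closed)

end
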